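(* Let $f,g_1,\ldots,g_s\in\mathbb{R}[\mathbf{x}]=\mathbb{R}[x_1,\ldots,x_n]$ and let $K=\{\mathbf{x}\in\mathbb{R}^n : g_i(\mathbf{x})\ge0,\ i=1,\ldots,s\}$ be compact. Let $f_K^*=\inf_{\mathbf{x}\in K}f(\mathbf{x})$ and let $f_{\rm sonc}^{(d,q)}$ ($d,q\in\mathbb{N}^*$) be the SONC lower bounds defined in the context. Then $$f_{\rm sonc}^{(d,q)}\uparrow f_K^*\quad\text{for } d,q\to\infty,$$ i.e. the values $f_{\rm sonc}^{(d,q)}$ are monotonically increasing (in the weak sense) in $d$ and in $q$ and converge to $f_K^*$ as $d,q\to\infty$.
   Context: Notation: $\mathbb{N}^*=\mathbb{N}\setminus\{0\}$. $\Delta_{n,2d}$ is the simplex with vertices $\mathbf{0},2d\,\mathbf{e}_1,\ldots,2d\,\mathbf{e}_n$ and $\mathcal{L}_{n,2d}=\Delta_{n,2d}\cap\mathbb{Z}^n$. $V(A)$ denotes the set of vertices of $\operatorname{conv}(A)$. A lattice point is even if it lies in $(2\mathbb{N})^n$. Circuit polynomials: Let $A\subset\mathbb{N}^n$ be finite with all elements of $V(A)$ even. A polynomial $f$ supported on $A$ is a circuit polynomial if $f(\mathbf{x})=\sum_{j=0}^r f_{\boldsymbol{\alpha}(j)}\mathbf{x}^{\boldsymbol{\alpha}(j)}+f_{\boldsymbol{\beta}}\mathbf{x}^{\boldsymbol{\beta}}$ with $r\le n$, $\boldsymbol{\alpha}(j),\boldsymbol{\beta}\in A$, $f_{\boldsymbol{\alpha}(j)}>0$,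 $f_{\boldsymbol{\beta}}\in\mathbb{R}$, such that (C1) $\boldsymbol{\alpha}(0),\ldots,\boldsymbol{\alpha}(r)$ are affinely independent and form $V(A)$; (C2) $\boldsymbol{\beta}=\sum_{j=0}^r\lambda_j\boldsymbol{\alpha}(j)$ with (unique) $\lambda_j>0$, $\sum_j\lambda_j=1$. $\operatorname{Circ}_A$ is the set of circuit polynomials with support $A$. SONC cone: $P_{n,2d}$ is the cone of polynomials in $n$ variables of degree at most $2d$ that are nonnegative on $\mathbb{R}^n$, and $C_{n,2d}=\{\sum_{i=1}^k\mu_ip_i : k\in\mathbb{N}^*,\ \mu_i\ge0,\ p_i\in\operatorname{Circ}_{A}\cap P_{n,2d} \text{ for some } A\subseteq\mathcal{L}_{n,2d}\text{ (depending on } i)\}$. SONC bounds: Since $K$ is compact, fix $N\in\mathbb{N}$ with $K\subseteq[-N,N]^n$ and let $l_1,\ldots,l_{2n}$ be the redundant linear constraint polynomials $N+x_i,\ N-x_i$ ($i=1,\ldots,n$). For $q\in\mathbb{N}^*$ let $R_q(K)=\{\prod_{k=1}^qh_k : h_k\in\{1,g_1,\ldots,g_s,l_1,\ldots,l_{2n}\}\}=\{H_1,\ldots,H_{\rho_q}\}$ with $\rho_q=|R_q(K)|$. Define $$f_{\rm sonc}^{(d,q)}=\sup\Big\{\gamma\in\mathbb{R} : f(\mathbf{x})-\gamma=\sum_{j=1}^{\rho_q}s_j(\mathbf{x})H_j(\mathbf{x})\text{ for some } s_1,\ldots,s_{\rho_q}\in C_{n,2d}\Big\},$$ with the conventions $\sup\emptyset=-\infty$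 and $\inf\emptyset=+\infty$. *)

theory Defs
  imports "HOL-Analysis.Analysis" "HOL-Library.Poly_Mapping"
begin

type_synonym 'n monom = "'n \<Rightarrow>\<^sub>0 nat"
type_synonym 'n mpoly = "'n monom \<Rightarrow>\<^sub>0 real"

definition const_poly :: "real \<Rightarrow> 'n mpoly" where
  "const_poly c = Poly_Mapping.single 0 c"

definition var_poly :: "'n \<Rightarrow> 'n mpoly" where
  "var_poly i = Poly_Mapping.single (Poly_Mapping.single i 1) 1"

definition poly_eval :: "'n::finite mpoly \<Rightarrow> real ^ 'n \<Rightarrow> real" where
  "poly_eval p x = (\<Sum>m\<in>Poly_Mapping.keys p. Poly_Mapping.lookup p m * (\<Prod>i\<in>UNIV. x $ i ^ Poly_Mapping.lookup m i))"

text \<open>The zero polynomial gets total degree 0.\<close>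

definition total_degree :: "'n::finite mpoly \<Rightarrow> nat" where
  "total_degree p = Max (insert 0 ((\<lambda>m. \<Sum>i\<in>UNIV. Poly_Mapping.lookup m i) ` Poly_Mapping.keys p))"

definition exponent_vec :: "'n::finite monom \<Rightarrow> real ^ 'n" where
  "exponent_vec a = (\<chi> i. real (Poly_Mapping.lookup a i))"

definition even_monom :: "'n monom \<Rightarrow> bool" where
  "even_monom a \<longleftrightarrow> (\<forall>i. even (Poly_Mapping.lookup a i))"

text \<open>The vertices of a polytope are its extreme points; those of the convex hull of \<open>A\<close>
  belong to \<open>A\<close>, so \<open>V(A)\<close> can be taken as a set of exponents.\<close>

definition vertices :: "'n::finite monom set \<Rightarrow> 'n monom set" where
  "vertices A = {a \<in> A. exponent_vec a extreme_point_of (convex hull (exponent_vec ` A))}"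

text \<open>For \<open>r = 0\<close> the point \<open>\<beta>\<close> coincides with \<open>\<alpha> 0\<close>, and the two terms add up.
  \<^const>\<open>affine_dependent\<close> speaks about sets, hence the separate injectivity condition.\<close>

definition circuit_polys :: "'n::finite monom set \<Rightarrow> 'n mpoly set" where
  "circuit_polys A =
    {p. finite A \<and> (\<forall>a\<in>vertices A. even_monom a) \<and>
      (\<exists>(r::nat) (\<alpha> :: nat \<Rightarrow> 'n monom) (\<beta> :: 'n monom) (c :: nat \<Rightarrow> real) (b :: real).
         r \<le> CARD('n) \<and> (\<forall>j\<le>r. \<alpha> j \<in> A) \<and> \<beta> \<in> A \<and> (\<forall>j\<le>r. c j > 0) \<and>
         p = (\<Sum>j\<le>r. Poly_Mapping.single (\<alpha> j) (c j)) + Poly_Mapping.single \<beta> b \<and>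
         inj_on \<alpha> {..r} \<and> \<not> affine_dependent (exponent_vec ` \<alpha> ` {..r}) \<and>
         \<alpha> ` {..r} = vertices A \<and>
         (\<exists>l :: nat \<Rightarrow> real. (\<forall>j\<le>r. l j > 0) \<and> (\<Sum>j\<le>r. l j) = 1 \<and>
            exponent_vec \<beta> = (\<Sum>j\<le>r. l j *\<^sub>R exponent_vec (\<alpha> j))))}"

definition scaled_simplex :: "nat \<Rightarrow> (real ^ 'n::finite) set" where
  "scaled_simplex k = convex hull (insert 0 (range (\<lambda>i. real k *\<^sub>R axis i 1)))"

definition simplex_lattice_points :: "nat \<Rightarrow> (real ^ 'n::finite) set" where
  "simplex_lattice_points k = scaled_simplex k \<inter> {v. \<forall>i. v $ i \<in> \<int>}"

definition nonneg_polys :: "nat \<Rightarrow> 'n::finite mpoly set" where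
  "nonneg_polys k = {p. total_degree p \<le> k \<and> (\<forall>x. poly_eval p x \<ge> 0)}"

text \<open>As for \<^const>\<open>nonneg_polys\<close>, the argument is the degree bound, i.e. \<open>C\<^bsub>n,2d\<^esub>\<close> is
  \<open>sonc_cone (2 * d)\<close>.\<close>

definition sonc_cone :: "nat \<Rightarrow> 'n::finite mpoly set" where
  "sonc_cone D =
    {\<Sum>i=1..k. const_poly (\<mu> i) * p i | (k::nat) (\<mu> :: nat \<Rightarrow> real) (p :: nat \<Rightarrow> 'n mpoly).
       k \<ge> 1 \<and> (\<forall>i\<in>{1..k}. \<mu> i \<ge> 0 \<and>
         (\<exists>A. exponent_vec ` A \<subseteq> simplex_lattice_points D \<and>
              p i \<in> circuit_polys A \<inter> nonneg_polys D))}"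

definition feasible_set :: "nat \<Rightarrow> (nat \<Rightarrow> 'n::finite mpoly) \<Rightarrow> (real ^ 'n) set" where
  "feasible_set s g = {x. \<forall>i\<in>{1..s}. poly_eval (g i) x \<ge> 0}"

definition box_constraints :: "nat \<Rightarrow> 'n mpoly set" where
  "box_constraints N =
     range (\<lambda>i. const_poly (real N) + var_poly i) \<union> range (\<lambda>i. const_poly (real N) - var_poly i)"

definition constraint_products ::
    "nat \<Rightarrow> (nat \<Rightarrow> 'n mpoly) \<Rightarrow> nat \<Rightarrow> nat \<Rightarrow> 'n mpoly set" where
  "constraint_products s g N q =
     {\<Prod>k=1..q. h k | h :: nat \<Rightarrow> 'n mpoly.
        \<forall>k\<in>{1..q}. h k \<in> {1} \<union> g ` {1..s} \<union> box_constraints N}"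

text \<open>The multipliers are indexed by the (finitely many) distinct products themselves.\<close>

definition sonc_bound ::
    "'n::finite mpoly \<Rightarrow> nat \<Rightarrow> (nat \<Rightarrow> 'n mpoly) \<Rightarrow> nat \<Rightarrow> nat \<Rightarrow> nat \<Rightarrow> ereal" where
  "sonc_bound f s g N d q =
     Sup (ereal ` {\<gamma>. \<exists>\<sigma> :: 'n mpoly \<Rightarrow> 'n mpoly.
        (\<forall>H\<in>constraint_products s g N q. \<sigma> H \<in> sonc_cone (2 * d)) \<and>
        f - const_poly \<gamma> = (\<Sum>H\<in>constraint_products s g N q. \<sigma> H * H)})"

end

theory Submission
  imports Defs "HOL-Real_Asymp.Real_Asymp"
begin

text \<open>Constant multipliers already suffice for convergence: by Krivine's Positivstellensatz, a
  polynomial that is positive on \<open>K\<close> is a combination, with nonnegative coefficients, of products of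
  the constraints and of the bounds \<open>N \<plusminus> x\<^sub>i\<close>. On a cube this holds because the coefficients of a
  polynomial in the tensor product Bernstein basis of order \<open>q\<close> converge uniformly to its values at
  the grid points. In general, scale the constraints so that \<open>\<bar>g\<bar> < 1\<close> on the cube; then, for
  suitable \<open>C\<close> and \<open>k\<close>, the polynomial \<open>f - C \<cdot> (\<Sum>g. g (1 - g)\<^sup>k)\<close> is positive on the whole cube, because
  \<open>t (1 - t)\<^sup>k\<close> is at most \<open>1/k\<close> on \<open>[0, 1]\<close> and at most \<open>t\<close> for \<open>t \<le> 0\<close>; and each \<open>1 - g\<close> is itself positive on
  the cube.\<close>

subsection \<open>Evaluation and induction for polynomials\<close>

lemma const_poly_0 [simp]: "const_poly 0 = 0"
  and const_poly_1 [simp]: "const_poly 1 = 1"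
  and const_poly_add: "const_poly (a + b) = const_poly a + const_poly b"
  and const_poly_diff: "const_poly (a - b) = const_poly a - const_poly b"
  and const_poly_mult: "const_poly (a * b) = const_poly a * const_poly b"
  by (simp_all add: const_poly_def single_add single_diff mult_single)

lemma const_poly_of_nat: "const_poly (of_nat n) = of_nat n"
  by (simp add: const_poly_def)

lemma const_poly_prod: "const_poly (\<Prod>i\<in>I. a i) = (\<Prod>i\<in>I. const_poly (a i))"
  by (induction I rule: infinite_finite_induct) (simp_all add: const_poly_mult)

lemma mpoly_sum_singles:
  "p = (\<Sum>m\<in>Poly_Mapping.keys p. Poly_Mapping.single m (Poly_Mapping.lookup p m))"
  by (rule poly_mapping_eqI) (auto simp: lookup_sum lookup_single when_def in_keys_iff)

lemma monom_induct [case_names zero single]: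
  fixes m :: "'n::finite monom"
  assumes "P 0" and "\<And>m i. P m \<Longrightarrow> P (m + Poly_Mapping.single i 1)"
  shows "P m"
proof (induction "\<Sum>i\<in>UNIV. Poly_Mapping.lookup m i" arbitrary: m)
  case 0
  then have "m = 0"
    by (intro poly_mapping_eqI) auto
  with assms(1) show ?case by simp
next
  case (Suc k)
  then have "\<exists>i. Poly_Mapping.lookup m i \<noteq> 0"
    by (metis sum.neutral nat.distinct(1))
  then obtain i where i: "Poly_Mapping.lookup m i \<noteq> 0" ..
  define m' where "m' = m - Poly_Mapping.single i 1"
  have m: "m = m' + Poly_Mapping.single i 1"
    using i by (intro poly_mapping_eqI) (auto simp: m'_def lookup_add lookup_minus lookup_single when_def)
  have "k = (\<Sum>i\<in>UNIV. Poly_Mapping.lookup m' i)"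
    using Suc(2) by (simp add: m lookup_add sum.distrib lookup_single when_def)
  from Suc(1)[OF this] assms(2) m show ?case by simp
qed

text \<open>Every monomial arises from a constant by multiplying with one variable at a time, so a
  single variable is the only factor to be treated. In \<open>bernstein_approx\<close> that factor
  merely raises one exponent.\<close>

lemma mpoly_induct [case_names const add var]:
  fixes p :: "'n::finite mpoly"
  assumes const: "\<And>c. P (const_poly c)"
    and add: "\<And>p q. P p \<Longrightarrow> P q \<Longrightarrow> P (p + q)"
    and var: "\<And>p i. P p \<Longrightarrow> P (p * var_poly i)"
  shows "P p"
proof -
  have single: "P (Poly_Mapping.single m c)" for m c
  proof (induction m rule: monom_induct)
    case zero
    show ?case using const[of c] by (simp add: const_poly_def)
  next
    case (single m i)
    from var[OF this, of i] show ?case by (simp add: var_poly_def mult_single)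
  qed
  have "P (\<Sum>m\<in>M. Poly_Mapping.single m (Poly_Mapping.lookup p m))" for M
    by (induction M rule: infinite_finite_induct) (use const[of 0] single add in auto)
  then show ?thesis by (subst mpoly_sum_singles)
qed

lemma poly_eval_0 [simp]: "poly_eval 0 x = 0"
  by (simp add: poly_eval_def)

lemma poly_eval_add [simp]: "poly_eval (p + q) x = poly_eval p x + poly_eval q x"
  unfolding poly_eval_def
  by (rule setsum_keys_plus_distrib) (auto simp: algebra_simps)

lemma poly_eval_single:
  "poly_eval (Poly_Mapping.single m c) x = c * (\<Prod>i\<in>UNIV. x $ i ^ Poly_Mapping.lookup m i)"
  by (simp add: poly_eval_def)

lemma poly_eval_const [simp]: "poly_eval (const_poly c) x = c"
  by (simp add: const_poly_def poly_eval_single)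

lemma poly_eval_1 [simp]: "poly_eval 1 x = 1"
  using poly_eval_const[of 1 x] by (simp del: poly_eval_const)

lemma poly_eval_var [simp]: "poly_eval (var_poly i) x = x $ i"
  by (simp add: var_poly_def poly_eval_single lookup_single when_def if_distrib[of "\<lambda>n. _ ^ n"]
      prod.delta cong: if_cong)

lemma poly_eval_sum [simp]: "poly_eval (\<Sum>i\<in>I. p i) x = (\<Sum>i\<in>I. poly_eval (p i) x)"
  by (induction I rule: infinite_finite_induct) simp_all

text \<open>Both sides are biadditive, so comparing products of single terms suffices.\<close>

lemma poly_eval_mult [simp]: "poly_eval (p * q) x = poly_eval p x * poly_eval q x"
proof -
  have "poly_eval (Poly_Mapping.single m a * Poly_Mapping.single m' b) x =
      poly_eval (Poly_Mapping.single m a) x * poly_eval (Poly_Mapping.single m' b) x" for m m' a b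
    by (simp add: mult_single poly_eval_single lookup_add power_add prod.distrib)
  then have "poly_eval ((\<Sum>m\<in>Poly_Mapping.keys p. Poly_Mapping.single m (Poly_Mapping.lookup p m)) *
        (\<Sum>m\<in>Poly_Mapping.keys q. Poly_Mapping.single m (Poly_Mapping.lookup q m))) x =
      poly_eval (\<Sum>m\<in>Poly_Mapping.keys p. Poly_Mapping.single m (Poly_Mapping.lookup p m)) x *
      poly_eval (\<Sum>m\<in>Poly_Mapping.keys q. Poly_Mapping.single m (Poly_Mapping.lookup q m)) x"
    by (simp add: sum_product)
  then show ?thesis by (simp flip: mpoly_sum_singles)
qed

lemma poly_eval_uminus [simp]: "poly_eval (- p) x = - poly_eval p x"
  using poly_eval_add[of p "- p" x] by (simp del: poly_eval_add)

lemma poly_eval_diff [simp]: "poly_eval (p - q) x = poly_eval p x - poly_eval q x"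
  using poly_eval_add[of p "- q" x] by (simp del: poly_eval_add)

lemma poly_eval_power [simp]: "poly_eval (p ^ k) x = poly_eval p x ^ k"
  by (induction k) simp_all

lemma poly_eval_prod [simp]: "poly_eval (\<Prod>i\<in>I. p i) x = (\<Prod>i\<in>I. poly_eval (p i) x)"
  by (induction I rule: infinite_finite_induct) simp_all

lemma continuous_on_poly_eval: "continuous_on S (poly_eval p)"
proof -
  have "poly_eval p = (\<lambda>x. \<Sum>m\<in>Poly_Mapping.keys p.
      Poly_Mapping.lookup p m * (\<Prod>i\<in>UNIV. x $ i ^ Poly_Mapping.lookup m i))"
    by (rule ext) (simp add: poly_eval_def)
  then show ?thesis by (auto intro!: continuous_intros)
qed

text \<open>The semiring generated by \<open>G\<close> and the nonnegative constants. In contrast to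
  a preordering, squares are not adjoined, so its elements are nonnegative combinations of products
  of generators.\<close>

inductive_set preprime :: "'n mpoly set \<Rightarrow> 'n mpoly set" for G :: "'n mpoly set" where
  const: "c \<ge> 0 \<Longrightarrow> const_poly c \<in> preprime G"
| base: "p \<in> G \<Longrightarrow> p \<in> preprime G"
| add: "p \<in> preprime G \<Longrightarrow> q \<in> preprime G \<Longrightarrow> p + q \<in> preprime G"
| mult: "p \<in> preprime G \<Longrightarrow> q \<in> preprime G \<Longrightarrow> p * q \<in> preprime G"

lemma preprime_0: "0 \<in> preprime G" and preprime_1: "1 \<in> preprime G"
  using preprime.const[of 0 G] preprime.const[of 1 G] by simp_all

lemma preprime_sum: "(\<And>i. i \<in> I \<Longrightarrow> p i \<in> preprime G) \<Longrightarrow> (\<Sum>i\<in>I. p i) \<in> preprime G"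
  by (induction I rule: infinite_finite_induct) (auto intro: preprime_0 preprime.add)

lemma preprime_prod: "(\<And>i. i \<in> I \<Longrightarrow> p i \<in> preprime G) \<Longrightarrow> (\<Prod>i\<in>I. p i) \<in> preprime G"
  by (induction I rule: infinite_finite_induct) (auto intro: preprime_1 preprime.mult)

lemma preprime_power: "p \<in> preprime G \<Longrightarrow> p ^ k \<in> preprime G"
  by (induction k) (auto intro: preprime_1 preprime.mult)

lemma preprime_of_nat: "of_nat n \<in> preprime G"
  using preprime.const[of "real n" G] by (simp add: const_poly_of_nat)

subsection \<open>Bernstein approximation on a cube\<close>

text \<open>The ratio is the product of the factors \<open>(j - i) / (q - i)\<close> for
  \<open>i < m\<close>, and each of them differs from \<open>j / q\<close> by at most
  \<open>i / (q - i)\<close>, uniformly in \<open>j\<close>. The induction adds one factor at a time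
  and spends half of \<open>\<epsilon>\<close> on it.\<close>

lemma binomial_ratio_tendsto:
  fixes m :: nat and \<epsilon> :: real
  assumes "\<epsilon> > 0"
  shows "\<forall>\<^sub>F q in sequentially. \<forall>j\<le>q.
    \<bar>real (j choose m) / real (q choose m) - (real j / real q) ^ m\<bar> \<le> \<epsilon>"
  using assms
proof (induction m arbitrary: \<epsilon>)
  case 0
  then show ?case by simp
next
  case (Suc m)
  have lim: "((\<lambda>q. real m / (real q - real m)) \<longlongrightarrow> 0) sequentially"
    by real_asymp
  have "\<forall>\<^sub>F q in sequentially. real m / (real q - real m) < \<epsilon> / 2"
    using Suc.prems by (intro order_tendstoD(2)[OF lim]) simp
  moreover have "\<forall>\<^sub>F q in sequentially. \<forall>j\<le>q.
      \<bar>real (j choose m) / real (q choose m) - (real j / real q) ^ m\<bar> \<le> \<epsilon> / 2"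
    using Suc.prems by (intro Suc.IH) simp
  moreover have "\<forall>\<^sub>F q in sequentially. q > m" by (rule eventually_gt_at_top)
  ultimately show ?case
  proof eventually_elim
    case (elim q)
    show ?case
    proof (intro allI impI)
      fix j assume j: "j \<le> q"
      define a where "a = real (j choose m) / real (q choose m)"
      \<comment> \<open>The factor that leads from \<open>m\<close> to \<open>Suc m\<close>. It is
        negative for \<open>j < m\<close>, but then \<open>a = 0\<close>.\<close>
      define r where "r = (real j - real m) / (real q - real m)"
      have a01: "0 \<le> a" "a \<le> 1"
        using j elim(3) by (auto simp: a_def divide_le_eq intro!: binomial_right_mono)
      have step: "real (Suc m) * real (n choose Suc m) = (real n - real m) * real (n choose m)" for n
        using gbinomial_mult_1[of "real n" m] by (simp add: binomial_gbinomial algebra_simps)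
      have "real (j choose Suc m) / real (q choose Suc m) =
          (real (Suc m) * real (j choose Suc m)) / (real (Suc m) * real (q choose Suc m))"
        by (subst mult_divide_mult_cancel_left) auto
      also have "\<dots> = a * r"
        by (simp only: step) (simp add: a_def r_def mult.commute)
      finally have eq: "real (j choose Suc m) / real (q choose Suc m) = a * r" .
      have "r - real j / real q = - (real m / (real q - real m)) * ((real q - real j) / real q)"
        using elim(3) by (simp add: r_def field_simps)
      moreover have "\<bar>(real q - real j) / real q\<bar> \<le> 1"
        using j elim(3) by (simp add: divide_le_eq)
      ultimately have "\<bar>r - real j / real q\<bar> \<le> real m / (real q - real m) * 1"
        using elim(3) by (simp only: abs_mult abs_minus_cancel) (intro mult_mono, auto)
      then have r: "\<bar>r - real j / real q\<bar> \<le> \<epsilon> / 2" using elim(1) by linarith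
      have "a * r - (real j / real q) ^ Suc m =
          a * (r - real j / real q) + (a - (real j / real q) ^ m) * (real j / real q)"
        by (simp add: algebra_simps)
      also have "\<bar>\<dots>\<bar> \<le> 1 * (\<epsilon> / 2) + (\<epsilon> / 2) * 1"
      proof (intro order_trans[OF abs_triangle_ineq] add_mono)
        show "\<bar>a * (r - real j / real q)\<bar> \<le> 1 * (\<epsilon> / 2)"
          unfolding abs_mult using a01 r by (intro mult_mono) auto
        show "\<bar>(a - (real j / real q) ^ m) * (real j / real q)\<bar> \<le> (\<epsilon> / 2) * 1"
          unfolding abs_mult using elim j Suc.prems by (intro mult_mono) (auto simp: a_def divide_le_eq)
      qed
      finally show "\<bar>real (j choose Suc m) / real (q choose Suc m) - (real j / real q) ^ Suc m\<bar> \<le> \<epsilon>"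
        by (simp add: eq)
    qed
  qed
qed

lemma prod_diff_le:
  fixes a b :: "'i \<Rightarrow> real"
  assumes "\<And>i. i \<in> I \<Longrightarrow> 0 \<le> a i \<and> a i \<le> 1" "\<And>i. i \<in> I \<Longrightarrow> 0 \<le> b i \<and> b i \<le> 1"
  shows "\<bar>(\<Prod>i\<in>I. a i) - (\<Prod>i\<in>I. b i)\<bar> \<le> (\<Sum>i\<in>I. \<bar>a i - b i\<bar>)"
  using norm_prod_diff[of I a b] assms by (simp add: real_norm_def)

text \<open>The Bernstein expansion \<open>u\<^sup>m = \<Sum>\<^sub>j (j choose m) / (q choose m) \<cdot> (q choose j) u\<^sup>j v\<^sup>q\<^sup>-\<^sup>j\<close>
  is \<open>u\<^sup>m (u + v)\<^sup>q\<^sup>-\<^sup>m\<close> multiplied out.\<close>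

lemma bernstein_expansion:
  fixes u v :: "'n mpoly"
  assumes "u + v = 1" and "m \<le> q"
  shows "u ^ m = (\<Sum>j\<le>q. const_poly (real (j choose m) / real (q choose m)) *
    (of_nat (q choose j) * u ^ j * v ^ (q - j)))"
proof -
  have coeff: "const_poly (real (j choose m) / real (q choose m)) * of_nat (q choose j) =
      (of_nat ((q - m) choose (j - m)) :: 'n mpoly)" if "m \<le> j" "j \<le> q" for j
  proof -
    have "(q choose j) * (j choose m) = (q choose m) * ((q - m) choose (j - m))"
      using that by (rule choose_mult)
    then have "real (q choose j) * real (j choose m) = real (q choose m) * real ((q - m) choose (j - m))"
      by (metis of_nat_mult)
    then have "real (j choose m) / real (q choose m) * real (q choose j) = real ((q - m) choose (j - m))"
      using assms(2) by (simp add: field_simps)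
    then show ?thesis
      by (metis const_poly_mult const_poly_of_nat)
  qed
  have "u ^ m = u ^ m * (u + v) ^ (q - m)"
    using assms by simp
  also have "\<dots> = (\<Sum>k\<le>q - m. of_nat ((q - m) choose k) * u ^ (k + m) * v ^ (q - m - k))"
    by (simp add: binomial_ring sum_distrib_left power_add mult_ac)
  also have "\<dots> = (\<Sum>j\<in>{m..q}. of_nat ((q - m) choose (j - m)) * u ^ j * v ^ (q - j))"
    by (rule sum.reindex_bij_witness[where i = "\<lambda>j. j - m" and j = "\<lambda>k. k + m"])
      (use assms(2) in \<open>auto simp: add.commute\<close>)
  also have "\<dots> = (\<Sum>j\<in>{m..q}. const_poly (real (j choose m) / real (q choose m)) *
      (of_nat (q choose j) * u ^ j * v ^ (q - j)))"
    by (rule sum.cong) (auto simp flip: coeff simp: mult_ac)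
  also have "\<dots> = (\<Sum>j\<le>q. const_poly (real (j choose m) / real (q choose m)) *
      (of_nat (q choose j) * u ^ j * v ^ (q - j)))"
    by (rule sum.mono_neutral_left) (auto simp: binomial_eq_0)
  finally show ?thesis .
qed

section \<open>The tensor product Bernstein basis\<close>

text \<open>\<open>bary\<close> and \<open>bary'\<close> are the barycentric coordinates of the
  interval \<open>[-R, R]\<close> in direction \<open>i\<close>. For \<open>R > 0\<close> they are
  positive multiples of the bounds \<open>R + x_i\<close> and \<open>R - x_i\<close>, so they lie in
  every preprime that contains these.\<close>

definition bary :: "real \<Rightarrow> 'n \<Rightarrow> 'n mpoly" where
  "bary R i = const_poly (1 / (2 * R)) * (const_poly R + var_poly i)"

definition bary' :: "real \<Rightarrow> 'n \<Rightarrow> 'n mpoly" where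
  "bary' R i = const_poly (1 / (2 * R)) * (const_poly R - var_poly i)"

text \<open>Over \<open>UNIV\<close> extensionality is no restriction; the form fits
  \<open>prod_sum_PiE\<close>, which multiplies out a product of sums.\<close>

definition multi_indices :: "nat \<Rightarrow> ('n \<Rightarrow> nat) set" where
  "multi_indices q = (UNIV \<rightarrow>\<^sub>E {..q})"

definition bernstein_basis :: "real \<Rightarrow> nat \<Rightarrow> ('n::finite \<Rightarrow> nat) \<Rightarrow> 'n mpoly" where
  "bernstein_basis R q J =
    (\<Prod>i\<in>UNIV. of_nat (q choose J i) * bary R i ^ J i * bary' R i ^ (q - J i))"

text \<open>For \<open>R > 0\<close> this is the point whose barycentric coordinates
  \<open>bary R i\<close> are \<open>J i / q\<close>.\<close>

definition grid_point :: "real \<Rightarrow> nat \<Rightarrow> ('n::finite \<Rightarrow> nat) \<Rightarrow> real ^ 'n" where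
  "grid_point R q J = (\<chi> i. 2 * R * (real (J i) / real q) - R)"

text \<open>The expansion is asked for large \<open>q\<close> only, since \<open>q\<close> has to
  dominate the exponents. Leaving the coefficients existential makes closure under linear
  combinations immediate.\<close>

definition bernstein_approx :: "real \<Rightarrow> 'n::finite mpoly \<Rightarrow> bool" where
  "bernstein_approx R p \<longleftrightarrow> (\<exists>b :: nat \<Rightarrow> ('n \<Rightarrow> nat) \<Rightarrow> real.
     (\<forall>\<^sub>F q in sequentially. p = (\<Sum>J\<in>multi_indices q. const_poly (b q J) * bernstein_basis R q J)) \<and>
     (\<forall>\<epsilon>>0. \<forall>\<^sub>F q in sequentially. \<forall>J\<in>multi_indices q. \<bar>b q J - poly_eval p (grid_point R q J)\<bar> \<le> \<epsilon>))"

lemma finite_multi_indices [simp]: "finite (multi_indices q :: ('n::finite \<Rightarrow> nat) set)"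
  by (auto simp: multi_indices_def intro: finite_PiE)

lemma bary_add_bary':
  assumes "R > 0"
  shows "bary R i + bary' R i = 1"
proof -
  have "bary R i + bary' R i = const_poly (1 / (2 * R)) * (const_poly R + const_poly R)"
    by (simp add: bary_def bary'_def algebra_simps)
  also have "\<dots> = const_poly (1 / (2 * R) * (R + R))"
    by (simp only: const_poly_mult const_poly_add)
  finally show ?thesis using assms by simp
qed

lemma var_poly_eq_bary:
  assumes "R > 0"
  shows "var_poly i = const_poly (2 * R) * bary R i - const_poly R"
proof -
  have "const_poly (2 * R) * bary R i = const_poly (2 * R * (1 / (2 * R))) * (const_poly R + var_poly i)"
    unfolding const_poly_mult bary_def by (simp add: mult_ac)
  then show ?thesis using assms by simp
qed

lemma poly_eval_bary_grid_point:
  "R > 0 \<Longrightarrow> poly_eval (bary R i) (grid_point R q J) = real (J i) / real q"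
  by (simp add: bary_def grid_point_def)

lemma bernstein_approx_add:
  assumes "bernstein_approx R p" "bernstein_approx R p'"
  shows "bernstein_approx R (p + p')"
proof -
  obtain b where b: "\<forall>\<^sub>F q in sequentially. p = (\<Sum>J\<in>multi_indices q. const_poly (b q J) * bernstein_basis R q J)"
    "\<And>\<epsilon>. \<epsilon> > 0 \<Longrightarrow> \<forall>\<^sub>F q in sequentially. \<forall>J\<in>multi_indices q. \<bar>b q J - poly_eval p (grid_point R q J)\<bar> \<le> \<epsilon>"
    using assms(1) unfolding bernstein_approx_def by blast
  obtain b' where b': "\<forall>\<^sub>F q in sequentially. p' = (\<Sum>J\<in>multi_indices q. const_poly (b' q J) * bernstein_basis R q J)"
    "\<And>\<epsilon>. \<epsilon> > 0 \<Longrightarrow> \<forall>\<^sub>F q in sequentially. \<forall>J\<in>multi_indices q. \<bar>b' q J - poly_eval p' (grid_point R q J)\<bar> \<le> \<epsilon>"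
    using assms(2) unfolding bernstein_approx_def by blast
  show ?thesis
    unfolding bernstein_approx_def
  proof (intro exI[of _ "\<lambda>q J. b q J + b' q J"] conjI allI impI)
    show "\<forall>\<^sub>F q in sequentially. p + p' =
        (\<Sum>J\<in>multi_indices q. const_poly (b q J + b' q J) * bernstein_basis R q J)"
      using b(1) b'(1) by eventually_elim (simp add: const_poly_add algebra_simps sum.distrib)
    fix \<epsilon> :: real assume "\<epsilon> > 0"
    then have "\<epsilon> / 2 > 0" by simp
    from b(2)[OF this] b'(2)[OF this]
    show "\<forall>\<^sub>F q in sequentially. \<forall>J\<in>multi_indices q.
        \<bar>b q J + b' q J - poly_eval (p + p') (grid_point R q J)\<bar> \<le> \<epsilon>"
    proof eventually_elim
      case (elim q)
      show ?case
      proof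
        fix J :: "'a \<Rightarrow> nat" assume "J \<in> multi_indices q"
        with elim have "\<bar>b q J - poly_eval p (grid_point R q J)\<bar> \<le> \<epsilon> / 2"
          "\<bar>b' q J - poly_eval p' (grid_point R q J)\<bar> \<le> \<epsilon> / 2" by auto
        then show "\<bar>b q J + b' q J - poly_eval (p + p') (grid_point R q J)\<bar> \<le> \<epsilon>"
          by (simp only: poly_eval_add)
      qed
    qed
  qed
qed

lemma bernstein_approx_scale:
  assumes "bernstein_approx R p"
  shows "bernstein_approx R (const_poly c * p)"
proof -
  obtain b where b: "\<forall>\<^sub>F q in sequentially. p = (\<Sum>J\<in>multi_indices q. const_poly (b q J) * bernstein_basis R q J)"
    "\<And>\<epsilon>. \<epsilon> > 0 \<Longrightarrow> \<forall>\<^sub>F q in sequentially. \<forall>J\<in>multi_indices q. \<bar>b q J - poly_eval p (grid_point R q J)\<bar> \<le> \<epsilon>"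
    using assms unfolding bernstein_approx_def by blast
  show ?thesis
    unfolding bernstein_approx_def
  proof (intro exI[of _ "\<lambda>q J. c * b q J"] conjI allI impI)
    show "\<forall>\<^sub>F q in sequentially. const_poly c * p =
        (\<Sum>J\<in>multi_indices q. const_poly (c * b q J) * bernstein_basis R q J)"
      using b(1) by eventually_elim (simp add: const_poly_mult sum_distrib_left mult.assoc)
    fix \<epsilon> :: real assume \<epsilon>: "\<epsilon> > 0"
    \<comment> \<open>The summand 1 keeps the denominator positive when
      \<open>c = 0\<close>.\<close>
    then have "\<epsilon> / (\<bar>c\<bar> + 1) > 0" by simp
    from b(2)[OF this]
    show "\<forall>\<^sub>F q in sequentially. \<forall>J\<in>multi_indices q.
        \<bar>c * b q J - poly_eval (const_poly c * p) (grid_point R q J)\<bar> \<le> \<epsilon>"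
    proof eventually_elim
      case (elim q)
      show ?case
      proof
        fix J :: "'a \<Rightarrow> nat" assume "J \<in> multi_indices q"
        with elim have le: "\<bar>b q J - poly_eval p (grid_point R q J)\<bar> \<le> \<epsilon> / (\<bar>c\<bar> + 1)" by auto
        have "\<bar>c * b q J - poly_eval (const_poly c * p) (grid_point R q J)\<bar> =
            \<bar>c\<bar> * \<bar>b q J - poly_eval p (grid_point R q J)\<bar>"
          by (simp flip: abs_mult right_diff_distrib)
        also have "\<dots> \<le> (\<bar>c\<bar> + 1) * (\<epsilon> / (\<bar>c\<bar> + 1))"
          using le by (intro mult_mono) auto
        finally show "\<bar>c * b q J - poly_eval (const_poly c * p) (grid_point R q J)\<bar> \<le> \<epsilon>"
          by simp
      qed
    qed
  qed
qed

text \<open>Expanding each factor by \<open>bernstein_expansion\<close> and multiplying out yields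
  the tensor product basis, with products of binomial ratios as coefficients. By
  \<open>prod_diff_le\<close> the errors of the coordinates add up, so each coordinate is allowed
  \<open>\<epsilon> / CARD('n)\<close>.\<close>

lemma bernstein_approx_monomial:
  fixes e :: "'n::finite \<Rightarrow> nat"
  assumes "R > 0"
  shows "bernstein_approx R (\<Prod>i\<in>UNIV. bary R i ^ e i)"
  unfolding bernstein_approx_def
proof (intro exI[of _ "\<lambda>q J. \<Prod>i\<in>UNIV. real (J i choose e i) / real (q choose e i)"] conjI allI impI)
  have "\<forall>\<^sub>F q in sequentially. q \<ge> (\<Sum>i\<in>UNIV. e i)" by (rule eventually_ge_at_top)
  then have ev: "\<forall>\<^sub>F q in sequentially. \<forall>i. e i \<le> q"
    by eventually_elim (meson UNIV_I finite member_le_sum order_trans zero_le)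
  then show "\<forall>\<^sub>F q in sequentially. (\<Prod>i\<in>UNIV. bary R i ^ e i) =
      (\<Sum>J\<in>multi_indices q. const_poly (\<Prod>i\<in>UNIV. real (J i choose e i) / real (q choose e i)) *
        bernstein_basis R q J)"
  proof eventually_elim
    case (elim q)
    have "(\<Prod>i\<in>UNIV. bary R i ^ e i) =
      (\<Prod>i\<in>UNIV. \<Sum>j\<le>q. const_poly (real (j choose e i) / real (q choose e i)) *
        (of_nat (q choose j) * bary R i ^ j * bary' R i ^ (q - j)))"
      by (intro prod.cong refl bernstein_expansion bary_add_bary' assms elim[rule_format])
    then show ?case
      by (simp add: prod_sum_PiE multi_indices_def bernstein_basis_def const_poly_prod prod.distrib)
  qed
  fix \<epsilon> :: real assume \<epsilon>: "\<epsilon> > 0"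
  have "\<forall>\<^sub>F q in sequentially. \<forall>i. \<forall>j\<le>q.
      \<bar>real (j choose e i) / real (q choose e i) - (real j / real q) ^ e i\<bar> \<le> \<epsilon> / CARD('n)"
    using \<epsilon> by (intro eventually_all_finite binomial_ratio_tendsto) simp
  then show "\<forall>\<^sub>F q in sequentially. \<forall>J\<in>multi_indices q.
      \<bar>(\<Prod>i\<in>UNIV. real (J i choose e i) / real (q choose e i)) -
        poly_eval (\<Prod>i\<in>UNIV. bary R i ^ e i) (grid_point R q J)\<bar> \<le> \<epsilon>"
    using ev
  proof eventually_elim
    case (elim q)
    show ?case
    proof
      fix J :: "'n \<Rightarrow> nat" assume "J \<in> multi_indices q"
      then have J: "J i \<le> q" for i by (auto simp: multi_indices_def)
      have "\<bar>(\<Prod>i\<in>UNIV. real (J i choose e i) / real (q choose e i)) - (\<Prod>i\<in>UNIV. (real (J i) / real q) ^ e i)\<bar>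
          \<le> (\<Sum>i\<in>UNIV. \<bar>real (J i choose e i) / real (q choose e i) - (real (J i) / real q) ^ e i\<bar>)"
        using J elim(2) by (intro prod_diff_le) 
          (auto simp: divide_le_eq intro!: binomial_right_mono power_le_one)
      also have "\<dots> \<le> (\<Sum>i\<in>(UNIV :: 'n set). \<epsilon> / CARD('n))"
        using elim(1) J by (intro sum_mono) auto
      finally show "\<bar>(\<Prod>i\<in>UNIV. real (J i choose e i) / real (q choose e i)) -
          poly_eval (\<Prod>i\<in>UNIV. bary R i ^ e i) (grid_point R q J)\<bar> \<le> \<epsilon>"
        by (simp add: poly_eval_bary_grid_point[OF assms])
    qed
  qed
qed

lemma bernstein_approx:
  fixes p :: "'n::finite mpoly"
  assumes "R > 0"
  shows "bernstein_approx R p"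
proof -
  \<comment> \<open>The claim is strengthened by an arbitrary monomial in the barycentric
    coordinates. In the variable step, \<open>x_j = 2 R * bary R j - R\<close> gives one term with
    exponent \<open>e j\<close> raised by one and one with \<open>e\<close> unchanged.\<close>
  have "\<forall>e. bernstein_approx R (p * (\<Prod>i\<in>UNIV. bary R i ^ e i))"
  proof (induction p rule: mpoly_induct)
    case (const c)
    show ?case by (simp add: bernstein_approx_scale bernstein_approx_monomial assms)
  next
    case (add p q)
    then show ?case by (simp add: distrib_right bernstein_approx_add)
  next
    case (var p j)
    show ?case
    proof
      fix e
      define U where "U e = (\<Prod>i\<in>UNIV. bary R i ^ e i)" for e :: "'n \<Rightarrow> nat"
      have "U (e(j := Suc (e j))) = bary R j * U e"
        unfolding U_def by (subst (1 2) prod.remove[of _ j]) (simp_all add: mult_ac)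
      \<comment> \<open>The difference becomes a sum with a scaled term, the form to which the two
        closure lemmas apply.\<close>
      moreover have "const_poly (- R) = (- const_poly R :: 'n mpoly)"
        using const_poly_diff[of 0 R] by simp
      ultimately have "p * var_poly j * U e =
          const_poly (2 * R) * (p * U (e(j := Suc (e j)))) + const_poly (- R) * (p * U e)"
        by (simp add: var_poly_eq_bary[OF assms] algebra_simps)
      then show "bernstein_approx R (p * var_poly j * (\<Prod>i\<in>UNIV. bary R i ^ e i))"
        using var by (simp add: U_def bernstein_approx_add bernstein_approx_scale)
    qed
  qed
  from spec[OF this, of "\<lambda>_. 0"] show ?thesis by simp
qed

lemma bary_in_preprime:
  assumes "R > 0"
  shows "const_poly R + var_poly i \<in> preprime G \<Longrightarrow> bary R i \<in> preprime G"
    and "const_poly R - var_poly i \<in> preprime G \<Longrightarrow> bary' R i \<in> preprime G"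
  using assms unfolding bary_def bary'_def by (auto intro!: preprime.mult preprime.const)

text \<open>By compactness \<open>p\<close> has a positive minimum on the cube. Once the Bernstein
  coefficients are within this minimum of the values at the grid points, they are nonnegative, and
  the basis polynomials are products of preprime elements.\<close>

lemma preprime_of_pos_on_cube:
  fixes p :: "'n::finite mpoly"
  assumes "R > 0"
    and G: "\<And>i. const_poly R + var_poly i \<in> preprime G" "\<And>i. const_poly R - var_poly i \<in> preprime G"
    and pos: "\<And>x. x \<in> cbox (\<chi> i. - R) (\<chi> i. R) \<Longrightarrow> poly_eval p x > 0"
  shows "p \<in> preprime G"
proof -
  let ?B = "cbox (\<chi> i. - R) (\<chi> i. R) :: (real ^ 'n) set"
  have "0 \<in> ?B" using assms(1) by (simp add: mem_box_cart)
  then obtain x0 where x0: "x0 \<in> ?B" "\<And>x. x \<in> ?B \<Longrightarrow> poly_eval p x0 \<le> poly_eval p x"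
    using continuous_attains_inf[OF compact_cbox _ continuous_on_poly_eval] by blast
  obtain b where b: "\<forall>\<^sub>F q in sequentially. p = (\<Sum>J\<in>multi_indices q. const_poly (b q J) * bernstein_basis R q J)"
    "\<And>\<epsilon>. \<epsilon> > 0 \<Longrightarrow> \<forall>\<^sub>F q in sequentially. \<forall>J\<in>multi_indices q. \<bar>b q J - poly_eval p (grid_point R q J)\<bar> \<le> \<epsilon>"
    using bernstein_approx[OF assms(1), of p] unfolding bernstein_approx_def by blast
  have "\<forall>\<^sub>F q in sequentially. q > (0 :: nat) \<and>
    p = (\<Sum>J\<in>multi_indices q. const_poly (b q J) * bernstein_basis R q J) \<and>
    (\<forall>J\<in>multi_indices q. \<bar>b q J - poly_eval p (grid_point R q J)\<bar> \<le> poly_eval p x0)"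
    using eventually_gt_at_top b(1) b(2)[OF pos[OF x0(1)]] by (intro eventually_conj)
  then obtain q where q: "q > (0 :: nat)"
    and p: "p = (\<Sum>J\<in>multi_indices q. const_poly (b q J) * bernstein_basis R q J)"
    and close: "\<forall>J\<in>multi_indices q. \<bar>b q J - poly_eval p (grid_point R q J)\<bar> \<le> poly_eval p x0"
    by (auto simp: eventually_sequentially)
  have nonneg: "b q J \<ge> 0" if J: "J \<in> multi_indices q" for J
  proof -
    have "real (J i) / real q \<le> 1" for i
      using J q by (auto simp: multi_indices_def divide_le_eq)
    then have "2 * R * (real (J i) / real q) \<le> 2 * R * 1" for i
      using assms(1) by (intro mult_left_mono) auto
    then have "grid_point R q J \<in> ?B"
      using assms(1) by (auto simp: mem_box_cart grid_point_def)
    from x0(2)[OF this] bspec[OF close J] show ?thesis by linarith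
  qed
  have "bernstein_basis R q J \<in> preprime G" for J
    unfolding bernstein_basis_def
    by (intro preprime_prod preprime.mult preprime_of_nat preprime_power bary_in_preprime[OF assms(1)] G)
  then show ?thesis
    by (subst p) (intro preprime_sum preprime.mult preprime.const nonneg)
qed

subsection \<open>Krivine's Positivstellensatz\<close>

text \<open>For \<open>t >= 0\<close>, Bernoulli's inequality gives \<open>k t <= (1 + t)^k\<close>,
  and \<open>(1 + t) (1 - t) = 1 - t^2\<close> is at most 1. For \<open>t < 0\<close> the left side
  is nonpositive.\<close>

lemma mult_power_one_minus_le:
  fixes t :: real
  assumes "t \<le> 1" and "k > 0"
  shows "t * (1 - t) ^ k \<le> 1 / k"
proof (cases "t \<ge> 0")
  case True
  have "k * t * (1 - t) ^ k \<le> (1 + k * t) * (1 - t) ^ k"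
    using assms(1) by (intro mult_right_mono) auto
  also have "\<dots> \<le> (1 + t) ^ k * (1 - t) ^ k"
    using assms(1) True Bernoulli_inequality[of t k] by (intro mult_right_mono) (auto simp: mult.commute)
  also have "\<dots> = (1 - t\<^sup>2) ^ k"
    by (simp add: power_mult_distrib[symmetric] algebra_simps power2_eq_square)
  also have "\<dots> \<le> 1"
    using assms(1) True by (intro power_le_one) (auto simp: power_le_one)
  finally show ?thesis using assms(2) by (simp add: field_simps)
next
  case False
  then have "t * (1 - t) ^ k \<le> 0" by (intro mult_nonpos_nonneg) auto
  also have "\<dots> \<le> 1 / k" by simp
  finally show ?thesis .
qed

text \<open>The power is at least 1, so a violated constraint keeps its full negative size whatever
  \<open>k\<close> is.\<close>

lemma mult_power_one_minus_neg_le: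
  fixes t :: real
  assumes "t \<le> 0"
  shows "t * (1 - t) ^ k \<le> t"
  using mult_left_mono_neg[OF one_le_power[of "1 - t" k] assms] assms by simp

text \<open>The continuous function \<open>\<psi>\<close> adds the positive part of \<open>f\<close>
  to the violations of all constraints. It is positive on \<open>B\<close>, hence has a positive
  minimum there, and its summands cannot all be small.\<close>

lemma pos_or_constraint_violated:
  fixes f :: "'n::finite mpoly"
  assumes "finite G" and "compact B"
    and pos: "\<And>x. x \<in> B \<Longrightarrow> (\<And>g. g \<in> G \<Longrightarrow> poly_eval g x \<ge> 0) \<Longrightarrow> poly_eval f x > 0"
  obtains \<delta> where "\<delta> > 0" "\<And>x. x \<in> B \<Longrightarrow> poly_eval f x \<ge> \<delta> \<or> (\<exists>g\<in>G. poly_eval g x \<le> - \<delta>)"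
proof (cases "B = {}")
  case True
  then show ?thesis using that[of 1] by simp
next
  case False
  define \<psi> where "\<psi> x = max 0 (poly_eval f x) + (\<Sum>g\<in>G. max 0 (- poly_eval g x))" for x
  have "continuous_on B \<psi>"
    unfolding \<psi>_def by (intro continuous_intros continuous_on_poly_eval)
  then obtain x0 where x0: "x0 \<in> B" "\<And>x. x \<in> B \<Longrightarrow> \<psi> x0 \<le> \<psi> x"
    using continuous_attains_inf[OF assms(2) False] by blast
  have "\<psi> x0 > 0"
  proof (cases "\<forall>g\<in>G. poly_eval g x0 \<ge> 0")
    case True
    then show ?thesis
      using pos[OF x0(1)] by (auto simp: \<psi>_def intro!: add_pos_nonneg sum_nonneg)
  next
    case False
    then have "(\<Sum>g\<in>G. max 0 (- poly_eval g x0)) > 0"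
      using assms(1) by (auto simp: not_le intro!: sum_pos2)
    then show ?thesis by (auto simp: \<psi>_def intro!: add_nonneg_pos)
  qed
  \<comment> \<open>The minimum is divided evenly among the \<open>card G + 1\<close> summands of
    \<open>\<psi>\<close>.\<close>
  define \<delta> where "\<delta> = \<psi> x0 / (card G + 1)"
  have \<delta>: "\<delta> > 0" using \<open>\<psi> x0 > 0\<close> by (simp add: \<delta>_def)
  have "poly_eval f x \<ge> \<delta> \<or> (\<exists>g\<in>G. poly_eval g x \<le> - \<delta>)" if "x \<in> B" for x
  proof (rule ccontr)
    assume "\<not> ?thesis"
    then have *: "poly_eval f x < \<delta>" "\<And>g. g \<in> G \<Longrightarrow> poly_eval g x > - \<delta>"
      by (auto simp: not_le)
    \<comment> \<open>Only a weak inequality, since \<open>G\<close> may be empty; strictness comes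
      from the summand of \<open>f\<close>.\<close>
    have "(\<Sum>g\<in>G. max 0 (- poly_eval g x)) \<le> (\<Sum>g\<in>G. \<delta>)"
      using *(2) \<delta> by (intro sum_mono) force
    moreover have "max 0 (poly_eval f x) < \<delta>"
      using *(1) \<delta> by simp
    ultimately have "\<psi> x < \<delta> + card G * \<delta>"
      unfolding \<psi>_def sum_constant by linarith
    also have "\<dots> = (card G + 1) * \<delta>" by (simp add: algebra_simps)
    also have "\<dots> = \<psi> x0" by (simp add: \<delta>_def)
    finally show False using x0(2)[OF that] by simp
  qed
  with \<delta> that show ?thesis by blast
qed

text \<open>The bounds on the variables are required in the preprime rather than in
  \<open>G\<close>, so that bounds weaker than those in \<open>G\<close> can be used.\<close>

theorem krivine_positivstellensatz:
  fixes f :: "'n::finite mpoly"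
  assumes fin: "finite G" and "R > 0"
    and G: "\<And>i. const_poly R + var_poly i \<in> preprime G" "\<And>i. const_poly R - var_poly i \<in> preprime G"
    and pos: "\<And>x. (\<And>g. g \<in> G \<Longrightarrow> poly_eval g x \<ge> 0) \<Longrightarrow> poly_eval f x > 0"
  shows "f \<in> preprime G"
proof -
  let ?B = "cbox (\<chi> i. - R) (\<chi> i. R) :: (real ^ 'n) set"
  have "bounded (\<Union>h\<in>insert f G. poly_eval h ` ?B)"
    using fin by (intro bounded_UN ballI compact_imp_bounded compact_continuous_image
        continuous_on_poly_eval compact_cbox) auto
  then obtain M where M: "M > 0" "\<forall>y \<in> (\<Union>h\<in>insert f G. poly_eval h ` ?B). norm y < M"
    using bounded_pos_less by metis
  then have bound: "\<bar>poly_eval h x\<bar> < M" if "h \<in> insert f G" "x \<in> ?B" for h x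
    using that by auto
  obtain \<delta> where \<delta>: "\<delta> > 0" "\<And>x. x \<in> ?B \<Longrightarrow> poly_eval f x \<ge> \<delta> \<or> (\<exists>g\<in>G. poly_eval g x \<le> - \<delta>)"
    using pos_or_constraint_violated[OF fin compact_cbox, of _ _ f] pos by metis
  \<comment> \<open>Chosen so that \<open>C * (\<delta> / M) = M + \<delta>\<close>: a constraint
    violated by \<open>\<delta>\<close> then lifts \<open>f > - M\<close> above
    \<open>\<delta>\<close>.\<close>
  define C where "C = M * (M + \<delta>) / \<delta>"
  have C: "C > 0" using M \<delta> by (simp add: C_def)
  \<comment> \<open>With this \<open>k\<close>, the terms of the other constraints lower the result
    by less than \<open>\<delta>\<close>.\<close>
  obtain k :: nat where "C * card G / \<delta> < k" using reals_Archimedean2 by blast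
  moreover have "0 \<le> C * card G / \<delta>" using C \<delta> by simp
  ultimately have k: "k > 0"
    by linarith
  with \<open>C * card G / \<delta> < k\<close> have Ck: "C * card G / k < \<delta>"
    using \<delta>(1) by (simp add: field_simps)
  define t where "t g = const_poly (1 / M) * g" for g :: "'n mpoly"
  define S where "S = (\<Sum>g\<in>G. t g * (1 - t g) ^ k)"
  have small: "(\<Sum>g\<in>H. poly_eval (t g * (1 - t g) ^ k) x) \<le> card G / k" if "x \<in> ?B" "H \<subseteq> G" for x H
  proof -
    have "(\<Sum>g\<in>H. poly_eval (t g * (1 - t g) ^ k) x) \<le> (\<Sum>g\<in>H. 1 / k)"
    proof (rule sum_mono)
      fix g assume "g \<in> H"
      then have "poly_eval (t g) x \<le> 1"
        using bound[of g x] that M(1) by (auto simp: t_def divide_le_eq abs_less_iff)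
      from mult_power_one_minus_le[OF this k]
      show "poly_eval (t g * (1 - t g) ^ k) x \<le> 1 / k" by simp
    qed
    also have "\<dots> \<le> card G / k"
      using card_mono[OF fin that(2)] by (simp add: divide_right_mono)
    finally show ?thesis .
  qed
  have "poly_eval (f - const_poly C * S) x > 0" if x: "x \<in> ?B" for x
    using \<delta>(2)[OF x]
  proof
    assume "poly_eval f x \<ge> \<delta>"
    moreover have "C * poly_eval S x \<le> C * (card G / k)"
      using small[OF x subset_refl] C by (intro mult_left_mono) (auto simp: S_def)
    ultimately show ?thesis using Ck by simp
  next
    assume "\<exists>g\<in>G. poly_eval g x \<le> - \<delta>"
    then obtain g0 where g0: "g0 \<in> G" "poly_eval g0 x \<le> - \<delta>" by blast
    then have t: "poly_eval (t g0) x \<le> - \<delta> / M"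
      using divide_right_mono[OF g0(2), of M] M(1) by (simp add: t_def)
    have "- \<delta> / M \<le> 0" using \<delta>(1) M(1) by simp
    with t have "poly_eval (t g0) x \<le> 0" by linarith
    from mult_power_one_minus_neg_le[OF this, of k] t
    have "poly_eval (t g0 * (1 - t g0) ^ k) x \<le> - \<delta> / M" by simp
    moreover have "poly_eval S x = poly_eval (t g0 * (1 - t g0) ^ k) x +
        (\<Sum>g\<in>G - {g0}. poly_eval (t g * (1 - t g) ^ k) x)"
      unfolding S_def poly_eval_sum using fin g0(1) by (rule sum.remove)
    ultimately have "poly_eval S x \<le> - \<delta> / M + card G / k"
      using small[OF x, of "G - {g0}"] by auto
    then have "C * poly_eval S x \<le> C * (- \<delta> / M + card G / k)"
      using C by (intro mult_left_mono) auto
    moreover have "C * (- \<delta> / M) = - (M + \<delta>)"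
      using \<delta>(1) M(1) by (simp add: C_def)
    then have "C * (- \<delta> / M + card G / k) = - (M + \<delta>) + C * card G / k"
      by (simp only: distrib_left times_divide_eq_right)
    ultimately show ?thesis
      using Ck bound[of f x] x by simp
  qed
  with \<open>R > 0\<close> G have "f - const_poly C * S \<in> preprime G"
    by (rule preprime_of_pos_on_cube)
  moreover have "S \<in> preprime G"
    unfolding S_def
  proof (intro preprime_sum preprime.mult preprime_power)
    fix g assume g: "g \<in> G"
    then show "t g \<in> preprime G"
      unfolding t_def using M(1) by (intro preprime.mult preprime.const preprime.base) auto
    show "1 - t g \<in> preprime G"
      using \<open>R > 0\<close> G
    proof (rule preprime_of_pos_on_cube)
      fix x assume "x \<in> ?B"
      then show "poly_eval (1 - t g) x > 0"
        using bound[of g x] g M(1) by (simp add: t_def divide_less_eq abs_less_iff)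
    qed
  qed
  ultimately have "(f - const_poly C * S) + const_poly C * S \<in> preprime G"
    using C by (intro preprime.add preprime.mult preprime.const) auto
  then show ?thesis by simp
qed

subsection \<open>SONC bounds\<close>

lemma sonc_cone_nonneg:
  assumes "p \<in> sonc_cone D"
  shows "poly_eval p x \<ge> 0"
proof -
  obtain k :: nat and \<mu> :: "nat \<Rightarrow> real" and p' where p: "p = (\<Sum>i=1..k. const_poly (\<mu> i) * p' i)"
    and "\<forall>i\<in>{1..k}. \<mu> i \<ge> 0 \<and> (\<exists>A. exponent_vec ` A \<subseteq> simplex_lattice_points D \<and>
      p' i \<in> circuit_polys A \<inter> nonneg_polys D)"
    using assms unfolding sonc_cone_def by blast
  then have "\<mu> i \<ge> 0 \<and> poly_eval (p' i) x \<ge> 0" if "i \<in> {1..k}" for i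
    using that unfolding nonneg_polys_def by blast
  then show ?thesis by (auto simp: p intro!: sum_nonneg mult_nonneg_nonneg)
qed

text \<open>The degenerate circuit \<open>r = 0\<close> with \<open>\<beta> = \<alpha> 0 = 0\<close>
  is used. Splitting \<open>c\<close> as \<open>1 + (c - 1)\<close> keeps the outer coefficient
  strictly positive even when \<open>c = 0\<close>.\<close>

lemma const_poly_in_circuit_polys:
  assumes "c \<ge> 0"
  shows "const_poly c \<in> circuit_polys {0}"
proof -
  have [simp]: "exponent_vec 0 = 0" by (simp add: exponent_vec_def vec_eq_iff)
  have v: "vertices {0} = {0}" by (auto simp: vertices_def extreme_point_of_def)
  have "const_poly c = (\<Sum>j\<le>(0 :: nat). Poly_Mapping.single 0 (1 :: real)) + Poly_Mapping.single 0 (c - 1)"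
    by (simp add: const_poly_def single_diff)
  then show ?thesis
    unfolding circuit_polys_def
    by (auto simp: v even_monom_def
        intro!: exI[of _ "0 :: nat"] exI[of _ "\<lambda>_ :: nat. 0 :: 'a monom"] exI[of _ "\<lambda>_ :: nat. 1 :: real"]
          exI[of _ "0 :: 'a monom"] exI[of _ "c - 1"])
qed

text \<open>This turns a certificate with nonnegative constant multipliers into a SONC certificate
  for every degree bound.\<close>

lemma const_poly_in_sonc_cone:
  assumes "c \<ge> 0"
  shows "(const_poly c :: 'n::finite mpoly) \<in> sonc_cone D"
proof -
  have [simp]: "exponent_vec (0 :: 'n monom) = 0" by (simp add: exponent_vec_def vec_eq_iff)
  have "(0 :: real ^ 'n) \<in> simplex_lattice_points D"
    by (simp add: simplex_lattice_points_def scaled_simplex_def hull_inc)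
  then have A: "exponent_vec ` {0 :: 'n monom} \<subseteq> simplex_lattice_points D" by simp
  have "total_degree (const_poly c :: 'n mpoly) = 0"
    by (auto simp: total_degree_def const_poly_def)
  then have "(const_poly c :: 'n mpoly) \<in> circuit_polys {0} \<inter> nonneg_polys D"
    using const_poly_in_circuit_polys[OF assms] assms by (simp add: nonneg_polys_def)
  with A have "\<exists>A. exponent_vec ` A \<subseteq> simplex_lattice_points D \<and>
      (const_poly c :: 'n mpoly) \<in> circuit_polys A \<inter> nonneg_polys D" by blast
  then show ?thesis
    unfolding sonc_cone_def
    by (intro CollectI exI[of _ "1 :: nat"] exI[of _ "\<lambda>_. 1 :: real"] exI[of _ "\<lambda>_. const_poly c"]) simp
qed

lemma zero_in_sonc_cone: "0 \<in> sonc_cone D"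
  using const_poly_in_sonc_cone[of 0 D] by simp

text \<open>Only the vertices need checking: \<open>k e_i\<close> lies on the segment from 0 to
  \<open>k' e_i\<close>, at ratio \<open>k / k'\<close>.\<close>

lemma scaled_simplex_mono:
  assumes "k \<le> k'"
  shows "(scaled_simplex k :: (real ^ 'n::finite) set) \<subseteq> scaled_simplex k'"
  unfolding scaled_simplex_def
proof (rule hull_minimal)
  let ?S = "convex hull (insert 0 (range (\<lambda>i. real k' *\<^sub>R axis i 1))) :: (real ^ 'n) set"
  have 0: "0 \<in> ?S" by (simp add: hull_inc)
  have "real k *\<^sub>R axis i 1 \<in> ?S" for i :: 'n
  proof (cases "k' = 0")
    case True
    then show ?thesis using assms 0 by simp
  next
    case False
    have "real k' *\<^sub>R axis i 1 \<in> ?S" by (intro hull_inc) auto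
    then have "(1 - real k / real k') *\<^sub>R 0 + (real k / real k') *\<^sub>R (real k' *\<^sub>R axis i 1) \<in> ?S"
      using assms 0 by (intro convexD convex_convex_hull) (auto simp: divide_le_eq)
    then show ?thesis using False by simp
  qed
  with 0 show "insert 0 (range (\<lambda>i. real k *\<^sub>R axis i 1)) \<subseteq> ?S" by auto
qed (rule convex_convex_hull)

lemma sonc_cone_mono:
  assumes "D \<le> D'"
  shows "(sonc_cone D :: 'n::finite mpoly set) \<subseteq> sonc_cone D'"
proof -
  have "(simplex_lattice_points D :: (real ^ 'n) set) \<subseteq> simplex_lattice_points D'"
    using scaled_simplex_mono[OF assms] by (auto simp: simplex_lattice_points_def)
  moreover have "(nonneg_polys D :: 'n mpoly set) \<subseteq> nonneg_polys D'"
    using assms by (auto simp: nonneg_polys_def)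
  ultimately have ex: "\<exists>A. exponent_vec ` A \<subseteq> simplex_lattice_points D' \<and> p \<in> circuit_polys A \<inter> nonneg_polys D'"
    if "\<exists>A. exponent_vec ` A \<subseteq> simplex_lattice_points D \<and> p \<in> circuit_polys A \<inter> nonneg_polys D" for p :: "'n mpoly"
    using that by blast
  show ?thesis
  proof
    fix p :: "'n mpoly" assume "p \<in> sonc_cone D"
    then obtain k :: nat and \<mu> :: "nat \<Rightarrow> real" and p' where p: "p = (\<Sum>i=1..k. const_poly (\<mu> i) * p' i)" "k \<ge> 1"
      and p': "\<forall>i\<in>{1..k}. \<mu> i \<ge> 0 \<and> (\<exists>A. exponent_vec ` A \<subseteq> simplex_lattice_points D \<and>
        p' i \<in> circuit_polys A \<inter> nonneg_polys D)"
      unfolding sonc_cone_def by blast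
    have "\<forall>i\<in>{1..k}. \<mu> i \<ge> 0 \<and> (\<exists>A. exponent_vec ` A \<subseteq> simplex_lattice_points D' \<and>
        p' i \<in> circuit_polys A \<inter> nonneg_polys D')"
    proof (intro ballI conjI)
      fix i assume i: "i \<in> {1..k}"
      show "\<mu> i \<ge> 0" using p' i by blast
      show "\<exists>A. exponent_vec ` A \<subseteq> simplex_lattice_points D' \<and> p' i \<in> circuit_polys A \<inter> nonneg_polys D'"
        by (rule ex) (use p' i in blast)
    qed
    with p show "p \<in> sonc_cone D'"
      unfolding sonc_cone_def by blast
  qed
qed

section \<open>Products of the constraints and their nonnegative combinations\<close>

lemma constraint_products_0: "constraint_products s g N 0 = {1}"
  by (simp add: constraint_products_def)

text \<open>Splitting off the last factor presents the set as an image, so that finiteness and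
  closure under multiplication follow by induction on \<open>q\<close>.\<close>

lemma constraint_products_Suc:
  "constraint_products s g N (Suc q) =
    (\<lambda>(a, b). a * b) ` (constraint_products s g N q \<times> ({1} \<union> g ` {1..s} \<union> box_constraints N))"
  (is "?L = _ ` (_ \<times> ?F)")
proof (intro equalityI subsetI)
  fix p assume "p \<in> ?L"
  then obtain h where p: "p = (\<Prod>k=1..Suc q. h k)" and h: "\<forall>k\<in>{1..Suc q}. h k \<in> ?F"
    unfolding constraint_products_def by blast
  have "(\<Prod>k=1..q. h k) \<in> constraint_products s g N q"
    using h unfolding constraint_products_def by fastforce
  moreover have "h (Suc q) \<in> ?F" using h by auto
  ultimately show "p \<in> (\<lambda>(a, b). a * b) ` (constraint_products s g N q \<times> ?F)"
    using p by (intro image_eqI[of _ _ "(\<Prod>k=1..q. h k, h (Suc q))"]) auto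
next
  fix p assume "p \<in> (\<lambda>(a, b). a * b) ` (constraint_products s g N q \<times> ?F)"
  then obtain a b where p: "p = a * b" and a: "a \<in> constraint_products s g N q" and b: "b \<in> ?F"
    by (auto elim!: imageE SigmaE simp only: split_conv)
  from a obtain h where a_eq: "a = (\<Prod>k=1..q. h k)" and h: "\<forall>k\<in>{1..q}. h k \<in> ?F"
    unfolding constraint_products_def by blast
  have "p = (\<Prod>k=1..Suc q. (h(Suc q := b)) k)"
    by (simp add: p a_eq)
  moreover have "\<forall>k\<in>{1..Suc q}. (h(Suc q := b)) k \<in> ?F"
    using h b by (auto simp: le_Suc_eq)
  ultimately show "p \<in> ?L"
    unfolding constraint_products_def by blast
qed

text \<open>Sums over infinite sets are 0 by convention; finiteness makes the sum in
  \<open>sonc_bound\<close> a genuine one.\<close>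

lemma finite_constraint_products [simp]:
  "finite (constraint_products s g N q :: 'n::finite mpoly set)"
  by (induction q) (simp_all add: constraint_products_0 constraint_products_Suc box_constraints_def)

lemma constraint_products_mult:
  assumes "a \<in> constraint_products s g N q" "b \<in> constraint_products s g N q'"
  shows "a * b \<in> constraint_products s g N (q + q')"
  using assms(2)
proof (induction q' arbitrary: b)
  case 0
  with assms(1) show ?case by (simp add: constraint_products_0)
next
  case (Suc q')
  then obtain b' h where "b = b' * h" "b' \<in> constraint_products s g N q'"
    "h \<in> {1} \<union> g ` {1..s} \<union> box_constraints N"
    by (auto simp: constraint_products_Suc)
  with Suc.IH[of b'] show ?case
    by (auto simp: constraint_products_Suc mult.assoc[symmetric] intro!: image_eqI[of _ _ "(a * b', h)"])
qed

lemma one_in_constraint_products: "1 \<in> constraint_products s g N q"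
  by (induction q) (force simp: constraint_products_0 constraint_products_Suc)+

text \<open>A shorter product is padded with factors 1.\<close>

lemma constraint_products_mono:
  "q \<le> q' \<Longrightarrow> constraint_products s g N q \<subseteq> constraint_products s g N q'"
  using constraint_products_mult[OF _ one_in_constraint_products, of _ s g N q "q' - q"] by auto

lemma constraint_products_nonneg:
  assumes "feasible_set s g \<subseteq> cbox (\<chi> i. - real N) (\<chi> i. real N)" "x \<in> feasible_set s g"
    and "H \<in> constraint_products s g N q"
  shows "poly_eval H x \<ge> 0"
proof -
  have "- real N \<le> x $ i \<and> x $ i \<le> real N" for i
    using assms(1,2) by (auto simp: mem_box_cart subset_iff)
  then have "0 \<le> real N + x $ i \<and> 0 \<le> real N - x $ i" for i by (smt (verit))
  then have "poly_eval h x \<ge> 0" if "h \<in> {1} \<union> g ` {1..s} \<union> box_constraints N" for h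
    using that assms(2) by (auto simp: feasible_set_def box_constraints_def)
  with assms(3) show ?thesis
    unfolding constraint_products_def by (auto intro!: prod_nonneg)
qed

text \<open>The certificates with constant multipliers, graded by the length \<open>q\<close> of the
  products.\<close>

definition product_combinations ::
    "nat \<Rightarrow> (nat \<Rightarrow> 'n mpoly) \<Rightarrow> nat \<Rightarrow> nat \<Rightarrow> 'n mpoly set" where
  "product_combinations s g N q =
    {p. \<exists>c. (\<forall>H. c H \<ge> 0) \<and> p = (\<Sum>H\<in>constraint_products s g N q. const_poly (c H) * H)}"

lemma product_combinations_add:
  assumes "p \<in> product_combinations s g N q" "p' \<in> product_combinations s g N q"
  shows "p + p' \<in> product_combinations s g N q"
proof -
  obtain c c' where "\<forall>H. c H \<ge> 0" "\<forall>H. c' H \<ge> 0"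
    "p = (\<Sum>H\<in>constraint_products s g N q. const_poly (c H) * H)"
    "p' = (\<Sum>H\<in>constraint_products s g N q. const_poly (c' H) * H)"
    using assms unfolding product_combinations_def by blast
  then show ?thesis
    unfolding product_combinations_def
    by (intro CollectI exI[of _ "\<lambda>H. c H + c' H"]) (simp add: const_poly_add distrib_right sum.distrib)
qed

lemma scaled_product_in_product_combinations:
  fixes g :: "nat \<Rightarrow> 'n::finite mpoly"
  assumes "H \<in> constraint_products s g N q" "a \<ge> 0"
  shows "const_poly a * H \<in> product_combinations s g N q"
proof -
  have "const_poly a * H = (\<Sum>H'\<in>constraint_products s g N q. if H' = H then const_poly a * H' else 0)"
    using assms(1) by (subst sum.delta) auto
  also have "\<dots> = (\<Sum>H'\<in>constraint_products s g N q. const_poly (if H' = H then a else 0) * H')"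
    by (intro sum.cong) auto
  finally show ?thesis
    unfolding product_combinations_def using assms(2)
    by (intro CollectI exI[of _ "\<lambda>H'. if H' = H then a else 0"]) auto
qed

lemma product_combinations_sum:
  fixes g :: "nat \<Rightarrow> 'n::finite mpoly"
  shows "(\<And>i. i \<in> I \<Longrightarrow> p i \<in> product_combinations s g N q) \<Longrightarrow> (\<Sum>i\<in>I. p i) \<in> product_combinations s g N q"
  using scaled_product_in_product_combinations[OF one_in_constraint_products, of 0 s g N q]
  by (induction I rule: infinite_finite_induct) (auto intro: product_combinations_add)

lemma product_combinations_mult:
  fixes g :: "nat \<Rightarrow> 'n::finite mpoly"
  assumes "p \<in> product_combinations s g N q" "p' \<in> product_combinations s g N q'"
  shows "p * p' \<in> product_combinations s g N (q + q')"
proof -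
  obtain c c' where c: "\<And>H. c H \<ge> 0" "\<And>H. c' H \<ge> 0"
    and p: "p = (\<Sum>H\<in>constraint_products s g N q. const_poly (c H) * H)"
      "p' = (\<Sum>H\<in>constraint_products s g N q'. const_poly (c' H) * H)"
    using assms unfolding product_combinations_def by blast
  have "p * p' = (\<Sum>H\<in>constraint_products s g N q. \<Sum>H'\<in>constraint_products s g N q'.
      const_poly (c H * c' H') * (H * H'))"
    by (simp only: p sum_product) (simp add: const_poly_mult mult_ac)
  \<comment> \<open>Different pairs may have the same product, so the terms are collected by closure
    under sums instead of reindexing.\<close>
  also have "\<dots> \<in> product_combinations s g N (q + q')"
    using c by (intro product_combinations_sum scaled_product_in_product_combinations constraint_products_mult) auto
  finally show ?thesis .
qed

lemma product_combinations_mono: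
  fixes g :: "nat \<Rightarrow> 'n::finite mpoly"
  assumes "q \<le> q'" "p \<in> product_combinations s g N q"
  shows "p \<in> product_combinations s g N q'"
proof -
  have "const_poly 1 * 1 \<in> product_combinations s g N (q' - q)"
    by (intro scaled_product_in_product_combinations one_in_constraint_products) simp
  from product_combinations_mult[OF assms(2) this] show ?thesis using assms(1) by simp
qed

text \<open>Along the generation of the preprime, a sum needs the larger of the two lengths and a
  product needs their sum.\<close>

lemma preprime_imp_product_combination:
  fixes g :: "nat \<Rightarrow> 'n::finite mpoly"
  assumes "p \<in> preprime (g ` {1..s} \<union> box_constraints N)"
  shows "\<exists>q. p \<in> product_combinations s g N q"
  using assms
proof induction
  case (const c)
  from scaled_product_in_product_combinations[OF one_in_constraint_products this, of s g N 0]
  show ?case by auto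
next
  case (base h)
  then have "h \<in> constraint_products s g N (Suc 0)"
    unfolding constraint_products_Suc constraint_products_0 by force
  from scaled_product_in_product_combinations[OF this, of 1] show ?case by auto
next
  case (add p p')
  then obtain q q' where "p \<in> product_combinations s g N q" "p' \<in> product_combinations s g N q'" by blast
  then have "p + p' \<in> product_combinations s g N (max q q')"
    by (intro product_combinations_add) (auto elim: product_combinations_mono[rotated])
  then show ?case by blast
next
  case (mult p p')
  then show ?case using product_combinations_mult by blast
qed

section \<open>Monotonicity and convergence of the bounds\<close>

text \<open>A certificate remains valid for larger parameters: the cone grows with \<open>d\<close>,
  and the products that are new for \<open>q'\<close> receive the multiplier 0.\<close>

lemma sonc_bound_mono:
  fixes f :: "'n::finite mpoly"
  assumes "d \<le> d'" "q \<le> q'"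
  shows "sonc_bound f s g N d q \<le> sonc_bound f s g N d' q'"
  unfolding sonc_bound_def
proof (intro Sup_subset_mono image_mono subsetI CollectI)
  let ?P = "constraint_products s g N"
  fix \<gamma>
  assume "\<gamma> \<in> {\<gamma>. \<exists>\<sigma>. (\<forall>H\<in>?P q. \<sigma> H \<in> sonc_cone (2 * d)) \<and> f - const_poly \<gamma> = (\<Sum>H\<in>?P q. \<sigma> H * H)}"
  then obtain \<sigma> where \<sigma>: "\<forall>H\<in>?P q. \<sigma> H \<in> sonc_cone (2 * d)" "f - const_poly \<gamma> = (\<Sum>H\<in>?P q. \<sigma> H * H)"
    by blast
  define \<sigma>' where "\<sigma>' H = (if H \<in> ?P q then \<sigma> H else 0)" for H
  have "\<forall>H\<in>?P q'. \<sigma>' H \<in> sonc_cone (2 * d')"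
    using \<sigma>(1) sonc_cone_mono[of "2 * d" "2 * d'"] assms(1) by (auto simp: \<sigma>'_def zero_in_sonc_cone)
  moreover have "(\<Sum>H\<in>?P q. \<sigma> H * H) = (\<Sum>H\<in>?P q'. \<sigma>' H * H)"
    using constraint_products_mono[OF assms(2)] by (intro sum.mono_neutral_cong_left) (auto simp: \<sigma>'_def)
  ultimately show "\<exists>\<sigma>. (\<forall>H\<in>?P q'. \<sigma> H \<in> sonc_cone (2 * d')) \<and> f - const_poly \<gamma> = (\<Sum>H\<in>?P q'. \<sigma> H * H)"
    using \<sigma>(2) by auto
qed

text \<open>Multipliers and products are nonnegative on the feasible set, so every admissible
  \<open>\<gamma>\<close> is a lower bound of \<open>f\<close> there.\<close>

lemma sonc_bound_le_Inf:
  fixes f :: "'n::finite mpoly"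
  assumes "feasible_set s g \<subseteq> cbox (\<chi> i. - real N) (\<chi> i. real N)"
  shows "sonc_bound f s g N d q \<le> (INF x\<in>feasible_set s g. ereal (poly_eval f x))"
  unfolding sonc_bound_def
proof (intro Sup_least INF_greatest, elim imageE CollectE exE conjE)
  fix x \<gamma> z \<sigma>
  assume x: "x \<in> feasible_set s g" and z: "z = ereal \<gamma>"
    and \<sigma>: "\<forall>H\<in>constraint_products s g N q. \<sigma> H \<in> sonc_cone (2 * d)"
      "f - const_poly \<gamma> = (\<Sum>H\<in>constraint_products s g N q. \<sigma> H * H)"
  have "poly_eval f x - \<gamma> = poly_eval (f - const_poly \<gamma>) x" by simp
  also have "\<dots> = (\<Sum>H\<in>constraint_products s g N q. poly_eval (\<sigma> H) x * poly_eval H x)"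
    by (simp only: \<sigma>(2) poly_eval_sum poly_eval_mult)
  also have "\<dots> \<ge> 0"
    using \<sigma>(1) constraint_products_nonneg[OF assms x]
    by (intro sum_nonneg mult_nonneg_nonneg) (auto intro: sonc_cone_nonneg)
  finally show "z \<le> ereal (poly_eval f x)" by (simp add: z)
qed

text \<open>The positivstellensatz for \<open>f - \<gamma>\<close> gives constant multipliers, which
  is why one \<open>q\<close> serves for all \<open>d\<close>.\<close>

lemma sonc_bound_ge:
  fixes f :: "'n::finite mpoly"
  assumes "\<And>x. x \<in> feasible_set s g \<Longrightarrow> poly_eval f x > \<gamma>"
    and box: "feasible_set s g \<subseteq> cbox (\<chi> i. - real N) (\<chi> i. real N)"
  shows "\<exists>q. \<forall>d. ereal \<gamma> \<le> sonc_bound f s g N d q"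
proof -
  let ?G = "g ` {1..s} \<union> box_constraints N"
  \<comment> \<open>\<^term>\<open>N = 0\<close> is allowed, so the cube is enlarged to have nonempty interior.\<close>
  have eq: "const_poly (real N + 1) + var_poly i = (const_poly (real N) + var_poly i) + const_poly 1"
    "const_poly (real N + 1) - var_poly i = (const_poly (real N) - var_poly i) + const_poly 1" for i :: 'n
    by (simp_all add: const_poly_add)
  have "f - const_poly \<gamma> \<in> preprime ?G"
  proof (rule krivine_positivstellensatz[of _ "real N + 1"])
    fix x assume "\<And>h. h \<in> ?G \<Longrightarrow> poly_eval h x \<ge> 0"
    then have "x \<in> feasible_set s g" by (auto simp: feasible_set_def)
    then show "poly_eval (f - const_poly \<gamma>) x > 0" using assms(1) by simp
  next
    fix i
    have "const_poly (real N) + var_poly i \<in> ?G" "const_poly (real N) - var_poly i \<in> ?G"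
      by (auto simp: box_constraints_def)
    then show "const_poly (real N + 1) + var_poly i \<in> preprime ?G"
      "const_poly (real N + 1) - var_poly i \<in> preprime ?G"
      unfolding eq by (intro preprime.add preprime.const preprime.base; simp)+
  qed (auto simp: box_constraints_def)
  then obtain q where "f - const_poly \<gamma> \<in> product_combinations s g N q"
    using preprime_imp_product_combination by blast
  then obtain c where c: "\<And>H. c H \<ge> 0"
    "f - const_poly \<gamma> = (\<Sum>H\<in>constraint_products s g N q. const_poly (c H) * H)"
    unfolding product_combinations_def by blast
  have "ereal \<gamma> \<le> sonc_bound f s g N d q" for d
    unfolding sonc_bound_def
    using c by (intro Sup_upper imageI CollectI exI[of _ "\<lambda>H. const_poly (c H)"])
      (auto intro: const_poly_in_sonc_cone)
  then show ?thesis by blast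
qed

theorem theorem5p2:
  fixes f :: "'n::finite mpoly" and s :: nat and g :: "nat \<Rightarrow> 'n mpoly" and N :: nat
  assumes "compact (feasible_set s g)"
    and "feasible_set s g \<subseteq> cbox (\<chi> i. - real N) (\<chi> i. real N)"
  shows "(\<forall>q\<ge>1. mono_on {1..} (\<lambda>d. sonc_bound f s g N d q)) \<and>
    (\<forall>d\<ge>1. mono_on {1..} (\<lambda>q. sonc_bound f s g N d q)) \<and>
    ((\<lambda>(d, q). sonc_bound f s g N d q) \<longlongrightarrow> (INF x\<in>feasible_set s g. ereal (poly_eval f x)))
      (sequentially \<times>\<^sub>F sequentially)"
proof (intro conjI allI impI mono_onI)
  let ?I = "INF x\<in>feasible_set s g. ereal (poly_eval f x)"
  show "((\<lambda>(d, q). sonc_bound f s g N d q) \<longlongrightarrow> ?I) (sequentially \<times>\<^sub>F sequentially)"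
  proof (rule order_tendstoI)
    fix a assume "a < ?I"
    \<comment> \<open>A real number strictly below the infimum makes \<open>f - \<gamma>\<close>
      positive on the feasible set. It exists also when the infimum is infinite, as for an empty
      feasible set.\<close>
    then obtain \<gamma> where \<gamma>: "a < ereal \<gamma>" "ereal \<gamma> < ?I"
      using ereal_dense2 by blast
    have "poly_eval f x > \<gamma>" if "x \<in> feasible_set s g" for x
      using less_le_trans[OF \<gamma>(2) INF_lower[OF that]] by simp
    then obtain q0 where q0: "\<And>d. ereal \<gamma> \<le> sonc_bound f s g N d q0"
      using sonc_bound_ge[OF _ assms(2)] by blast
    have "a < sonc_bound f s g N d q" if "q \<ge> q0" for d q
      using \<gamma>(1) q0[of d] sonc_bound_mono[OF order_refl that] by (meson less_le_trans)
    then show "\<forall>\<^sub>F dq in sequentially \<times>\<^sub>F sequentially. a < (case dq of (d, q) \<Rightarrow> sonc_bound f s g N d q)"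
      unfolding eventually_prod_sequentially by auto
  next
    fix a assume "?I < a"
    then have "sonc_bound f s g N d q < a" for d q
      using sonc_bound_le_Inf[OF assms(2)] le_less_trans by blast
    then show "\<forall>\<^sub>F dq in sequentially \<times>\<^sub>F sequentially. (case dq of (d, q) \<Rightarrow> sonc_bound f s g N d q) < a"
      by (intro always_eventually) auto
  qed
qed (auto intro: sonc_bound_mono)

end
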